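(* Let $n,N\ge 1$ be integers, let $S=\{r=(r_1,\dots,r_n)\in\mathbb{Z}^n : 1\le r_i\le N \text{ for } 1\le i\le n\}$ and $L=N^n$. Suppose $a=(a_r)_{r\in S},\ b=(b_s)_{s\in S}\in\overline{\mathbb{R}_+^L}$ with $\|a\|_2=\|b\|_2=1$ and $\lambda_1,\lambda_2\in\mathbb{R}$ satisfy $$\lambda_1 a_r=\sum_{s\in S,\ s\neq r}\frac{b_s}{|s-r|^n}\quad (r\in S),\qquad \lambda_2 b_s=\sum_{r\in S,\ r\neq s}\frac{a_r}{|r-s|^n}\quad (s\in S).$$ Then $\lambda_1=\lambda_2=\lambda_N$, $a=b\in\mathbb{R}_+^L$, and this $a=b$ is unique (i.e. any two such solutions $(a,b,\lambda_1,\lambda_2)$ coincide).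
   Context: $|\cdot|$ on $\mathbb{R}^n$ is the Euclidean norm; $\|a\|_2=(\sum_{r\in S} a_r^2)^{1/2}$. Vectors in $\mathbb{R}^L$ are indexed by the points of $S$; $\mathbb{R}_+^L$ is the set of vectors with all entries strictly positive, $\overline{\mathbb{R}_+^L}$ the set of vectors with all entries nonnegative. The constant $\lambda_N$ is $$\lambda_N=\max_{\|a\|_2=\|b\|_2=1}\ \sum_{r,s\in S,\ r\neq s}\frac{a_r b_s}{|r-s|^n},$$ the maximum being over $a,b\in\mathbb{R}^L$.
   Formalization: For n=1, N=2 the claims a=b, positivity and uniqueness fail (a=(1,0), b=(0,1), λ_1=λ_2=1 is a solution), so these are stated only outside that case; λ_1=λ_2=λ_N is stated for all n,N≥1. *)

theory Defs
  imports "HOL-Analysis.Analysis"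
begin

definition grid :: "nat \<Rightarrow> (int ^ 'n) set" where
  "grid N = {r. \<forall>i. 1 \<le> r $ i \<and> r $ i \<le> int N}"

definition euclid_norm :: "int ^ 'n \<Rightarrow> real" where
  "euclid_norm r = norm (\<chi> i. real_of_int (r $ i) :: real ^ 'n)"

text \<open>Vectors indexed by the grid are functions on \<open>int ^ 'n\<close> of which only the
  values on \<open>grid N\<close> matter; their 2-norm is \<open>L2_set a (grid N)\<close>.
  The type argument of \<open>lambda_max\<close> supplies the dimension \<open>CARD('n)\<close>.
  \<open>GREATEST\<close> denotes a genuine maximum: if it were not attained, the value would be
  unspecified.\<close>

definition hilbert_form :: "nat \<Rightarrow> (int ^ 'n \<Rightarrow> real) \<Rightarrow> (int ^ 'n \<Rightarrow> real) \<Rightarrow> real" where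
  "hilbert_form N a b =
     (\<Sum>r\<in>grid N. \<Sum>s\<in>grid N - {r}. a r * b s / euclid_norm (r - s) ^ CARD('n))"

definition lambda_max :: "'n::finite itself \<Rightarrow> nat \<Rightarrow> real" where
  "lambda_max _ N =
     (GREATEST m. \<exists>a b :: int ^ 'n \<Rightarrow> real.
        L2_set a (grid N) = 1 \<and> L2_set b (grid N) = 1 \<and> m = hilbert_form N a b)"

definition nonneg_solution ::
  "nat \<Rightarrow> (int ^ 'n \<Rightarrow> real) \<Rightarrow> (int ^ 'n \<Rightarrow> real) \<Rightarrow> real \<Rightarrow> real \<Rightarrow> bool" where
  "nonneg_solution N a b \<mu>\<^sub>1 \<mu>\<^sub>2 \<longleftrightarrow>
     (\<forall>r\<in>grid N. 0 \<le> a r) \<and> (\<forall>s\<in>grid N. 0 \<le> b s) \<and>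
     L2_set a (grid N) = 1 \<and> L2_set b (grid N) = 1 \<and>
     (\<forall>r\<in>grid N. \<mu>\<^sub>1 * a r = (\<Sum>s\<in>grid N - {r}. b s / euclid_norm (s - r) ^ CARD('n))) \<and>
     (\<forall>s\<in>grid N. \<mu>\<^sub>2 * b s = (\<Sum>r\<in>grid N - {s}. a r / euclid_norm (r - s) ^ CARD('n)))"

text \<open>When \<open>CARD('n) = 1\<close> and \<open>N = 2\<close> the grid has just the two points 1 and 2, and
  \<open>a = (1, 0)\<close>, \<open>b = (0, 1)\<close>, \<open>\<mu>\<^sub>1 = \<mu>\<^sub>2 = 1\<close> is a solution with \<open>a \<noteq> b\<close>. Equality,
  positivity and uniqueness of the vectors therefore fail in this one case, although
  \<open>\<mu>\<^sub>1\<close> and \<open>\<mu>\<^sub>2\<close> still equal the maximum;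
  this is why that case is set apart in the theorem.\<close>

end

theory Submission
  imports Defs
begin

text \<open>
  Consider the symmetric kernel \<open>K\<^sub>r\<^sub>s = 1 / \<bar>r - s\<bar>\<^sup>n\<close>, which is positive off the diagonal.
  Symmetry gives \<open>\<mu>\<^sub>1 = \<mu>\<^sub>2 = \<mu>\<close>, the value of the form at \<open>(a, b)\<close>, so \<open>u = a + b\<close> is a
  nonnegative eigenvector of \<open>K\<close> for \<open>\<mu>\<close>, and it has no zeros.  For all \<open>x, y\<close>,
  \<open>(\<Sum>r\<noteq>s. K\<^sub>r\<^sub>s u\<^sub>r u\<^sub>s (x\<^sub>r/u\<^sub>r - y\<^sub>s/u\<^sub>s)\<^sup>2) = \<mu> (\<parallel>x\<parallel>\<^sup>2 + \<parallel>y\<parallel>\<^sup>2) - 2 (\<Sum>r\<noteq>s. K\<^sub>r\<^sub>s x\<^sub>r y\<^sub>s)\<close>.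
  The left-hand side is nonnegative, hence \<open>\<mu>\<close> is the maximum of the form.  At any maximiser
  \<open>x\<^sub>r/u\<^sub>r = y\<^sub>s/u\<^sub>s\<close> for all \<open>r \<noteq> s\<close>; as soon as there are three points, this forces both
  \<open>x\<close> and \<open>y\<close> to be the same multiple of \<open>u\<close>.  Apply this to \<open>(a, b)\<close> and to any other solution.
\<close>

section \<open>Bilinear forms of symmetric kernels with the diagonal left out\<close>

definition off_diag_form :: "'a set \<Rightarrow> ('a \<Rightarrow> 'a \<Rightarrow> real) \<Rightarrow> ('a \<Rightarrow> real) \<Rightarrow> ('a \<Rightarrow> real) \<Rightarrow> real" where
  "off_diag_form S K x y = (\<Sum>r\<in>S. \<Sum>s\<in>S - {r}. K r s * x r * y s)"

lemma sum_off_diag_swap: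
  fixes f :: "'a \<Rightarrow> 'a \<Rightarrow> 'b::comm_monoid_add"
  assumes "finite S"
  shows "(\<Sum>r\<in>S. \<Sum>s\<in>S - {r}. f r s) = (\<Sum>s\<in>S. \<Sum>r\<in>S - {s}. f r s)"
proof -
  have "S - {r} = {s \<in> S. r \<noteq> s}" "S - {r} = {s \<in> S. s \<noteq> r}" for r by auto
  then show ?thesis
    using sum.swap_restrict[OF assms assms, of f "(\<noteq>)"] by simp
qed

lemma L2_set_eq_1_iff: "L2_set x S = 1 \<longleftrightarrow> (\<Sum>r\<in>S. (x r)\<^sup>2) = 1"
  by (simp add: L2_set_def)

lemma off_diag_form_commute:
  assumes "finite S" and sym: "\<And>r s. K r s = K s r"
  shows "off_diag_form S K x y = off_diag_form S K y x"
proof -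
  have "off_diag_form S K x y = (\<Sum>s\<in>S. \<Sum>r\<in>S - {s}. K r s * x r * y s)"
    unfolding off_diag_form_def by (rule sum_off_diag_swap[OF assms(1)])
  also have "\<dots> = off_diag_form S K y x"
    unfolding off_diag_form_def by (intro sum.cong refl) (simp add: sym mult_ac)
  finally show ?thesis .
qed

text \<open>Pair the equation with \<open>x\<close> and use that \<open>x\<close> has norm 1.
  Applied to \<open>(a, b)\<close> and to \<open>(b, a)\<close>, this together with the symmetry of
  the form identifies the two eigenvalues.\<close>

lemma off_diag_form_eigen:
  assumes "\<And>r. r \<in> S \<Longrightarrow> \<mu> * x r = (\<Sum>s\<in>S - {r}. K r s * y s)" and "L2_set x S = 1"
  shows "off_diag_form S K x y = \<mu>"
proof -
  have "off_diag_form S K x y = (\<Sum>r\<in>S. x r * (\<mu> * x r))"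
    unfolding off_diag_form_def
    by (intro sum.cong refl) (simp add: assms(1) sum_distrib_left mult_ac)
  also have "\<dots> = \<mu> * (\<Sum>r\<in>S. (x r)\<^sup>2)"
    by (simp add: sum_distrib_left power2_eq_square mult_ac)
  finally show ?thesis using assms(2) by (simp add: L2_set_eq_1_iff)
qed

text \<open>At a zero \<open>r\<close> of \<open>u\<close> the equation becomes a vanishing sum of
  nonnegative terms with positive weights, so \<open>u\<close> would vanish at every other point
  too, including \<open>p\<close>.\<close>

lemma eigenvector_pos:
  fixes u :: "'a \<Rightarrow> real"
  assumes "finite S"
    and K_pos: "\<And>r s. r \<in> S \<Longrightarrow> s \<in> S \<Longrightarrow> r \<noteq> s \<Longrightarrow> 0 < K r s"
    and nonneg: "\<And>r. r \<in> S \<Longrightarrow> 0 \<le> u r"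
    and eigen: "\<And>r. r \<in> S \<Longrightarrow> \<mu> * u r = (\<Sum>s\<in>S - {r}. K r s * u s)"
    and "p \<in> S" "u p \<noteq> 0" "r \<in> S"
  shows "0 < u r"
proof (rule ccontr)
  assume "\<not> 0 < u r"
  with nonneg[OF \<open>r \<in> S\<close>] have u0: "u r = 0" by simp
  then have "(\<Sum>s\<in>S - {r}. K r s * u s) = 0"
    using eigen[OF \<open>r \<in> S\<close>] by simp
  moreover have "0 \<le> K r s * u s" if "s \<in> S - {r}" for s
    using K_pos[of r s] nonneg[of s] that \<open>r \<in> S\<close> by auto
  ultimately have "\<forall>s\<in>S - {r}. K r s * u s = 0"
    using \<open>finite S\<close> by (subst (asm) sum_nonneg_eq_0_iff) auto
  moreover have "p \<in> S - {r}" using u0 assms(5,6) by auto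
  ultimately have "K r p * u p = 0" by blast
  then show False
    using K_pos[of r p] \<open>p \<in> S - {r}\<close> \<open>r \<in> S\<close> \<open>u p \<noteq> 0\<close> by auto
qed

section \<open>The sum of squares attached to a positive eigenvector\<close>

context
  fixes S :: "'a set" and K :: "'a \<Rightarrow> 'a \<Rightarrow> real" and u :: "'a \<Rightarrow> real" and \<mu> :: real
  assumes fin: "finite S"
    and sym: "\<And>r s. K r s = K s r"
    and K_pos: "\<And>r s. r \<in> S \<Longrightarrow> s \<in> S \<Longrightarrow> r \<noteq> s \<Longrightarrow> 0 < K r s"
    and u_pos: "\<And>r. r \<in> S \<Longrightarrow> 0 < u r"
    and eigen: "\<And>r. r \<in> S \<Longrightarrow> \<mu> * u r = (\<Sum>s\<in>S - {r}. K r s * u s)"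
begin

text \<open>When the square is expanded, \<open>u\<close> cancels from the cross term, which leaves
  the form; in the two pure terms the eigenvector equation collapses the inner sum to \<mu> times a
  square.\<close>

lemma sum_off_diag_squares:
  "(\<Sum>r\<in>S. \<Sum>s\<in>S - {r}. K r s * u r * u s * (x r / u r - y s / u s)\<^sup>2) =
     \<mu> * ((\<Sum>r\<in>S. (x r)\<^sup>2) + (\<Sum>r\<in>S. (y r)\<^sup>2)) - 2 * off_diag_form S K x y"
proof -
  have expand: "K r s * u r * u s * (x r / u r - y s / u s)\<^sup>2 =
      (x r)\<^sup>2 / u r * (K r s * u s) + (y s)\<^sup>2 / u s * (K s r * u r) - 2 * (K r s * x r * y s)"
    if "r \<in> S" "s \<in> S - {r}" for r s
    using u_pos[of r] u_pos[of s] that sym[of r s]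
    by (simp add: field_simps power2_eq_square)
  have weighted: "(\<Sum>r\<in>S. \<Sum>s\<in>S - {r}. (z r)\<^sup>2 / u r * (K r s * u s)) = \<mu> * (\<Sum>r\<in>S. (z r)\<^sup>2)" for z
  proof -
    have "(\<Sum>s\<in>S - {r}. (z r)\<^sup>2 / u r * (K r s * u s)) = \<mu> * (z r)\<^sup>2" if "r \<in> S" for r
      unfolding sum_distrib_left[symmetric] eigen[OF that, symmetric]
      using u_pos[OF that] by simp
    then show ?thesis by (simp add: sum_distrib_left)
  qed
  have "(\<Sum>r\<in>S. \<Sum>s\<in>S - {r}. K r s * u r * u s * (x r / u r - y s / u s)\<^sup>2) =
      (\<Sum>r\<in>S. \<Sum>s\<in>S - {r}. (x r)\<^sup>2 / u r * (K r s * u s)) +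
      (\<Sum>r\<in>S. \<Sum>s\<in>S - {r}. (y s)\<^sup>2 / u s * (K s r * u r)) - 2 * off_diag_form S K x y"
    unfolding off_diag_form_def sum_distrib_left sum.distrib[symmetric] sum_subtractf[symmetric]
    by (intro sum.cong refl expand)
  \<comment> \<open>With the point of \<open>y\<close> as outer index, \<open>weighted\<close>
    applies to \<open>y\<close> as it does to \<open>x\<close>.\<close>
  also have "(\<Sum>r\<in>S. \<Sum>s\<in>S - {r}. (y s)\<^sup>2 / u s * (K s r * u r)) =
      (\<Sum>s\<in>S. \<Sum>r\<in>S - {s}. (y s)\<^sup>2 / u s * (K s r * u r))"
    by (rule sum_off_diag_swap[OF fin])
  finally show ?thesis by (simp only: weighted distrib_left)
qed

lemma off_diag_term_nonneg:
  assumes "r \<in> S" "s \<in> S - {r}"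
  shows "0 \<le> K r s * u r * u s * (x r / u r - y s / u s)\<^sup>2"
  using K_pos[of r s] u_pos[of r] u_pos[of s] assms by auto

lemma off_diag_form_le:
  assumes "L2_set x S = 1" "L2_set y S = 1"
  shows "off_diag_form S K x y \<le> \<mu>"
proof -
  have "0 \<le> (\<Sum>r\<in>S. \<Sum>s\<in>S - {r}. K r s * u r * u s * (x r / u r - y s / u s)\<^sup>2)"
    by (intro sum_nonneg off_diag_term_nonneg)
  then show ?thesis
    using assms by (simp add: sum_off_diag_squares L2_set_eq_1_iff)
qed

text \<open>Equality forces every square to vanish, but this links \<open>x\<close> only to values
  of \<open>y\<close> at other points. On two points it would leave two independent ratios; a third
  point ties them together.\<close>

lemma off_diag_maximiser:
  assumes "3 \<le> card S" "L2_set x S = 1" "L2_set y S = 1" "off_diag_form S K x y = \<mu>"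
  shows "\<exists>c. \<forall>r\<in>S. x r = c * u r \<and> y r = c * u r"
proof -
  have "(\<Sum>r\<in>S. \<Sum>s\<in>S - {r}. K r s * u r * u s * (x r / u r - y s / u s)\<^sup>2) = 0"
    using assms by (simp add: sum_off_diag_squares L2_set_eq_1_iff)
  then have "\<forall>r\<in>S. (\<Sum>s\<in>S - {r}. K r s * u r * u s * (x r / u r - y s / u s)\<^sup>2) = 0"
    by (subst (asm) sum_nonneg_eq_0_iff) (auto intro!: fin sum_nonneg off_diag_term_nonneg simp only:)
  then have "\<forall>s\<in>S - {r}. K r s * u r * u s * (x r / u r - y s / u s)\<^sup>2 = 0" if "r \<in> S" for r
    using that fin off_diag_term_nonneg[OF that] by (subst sum_nonneg_eq_0_iff[symmetric]) auto
  then have ratio: "x r / u r = y s / u s" if "r \<in> S" "s \<in> S" "r \<noteq> s" for r s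
    using that K_pos[of r s] u_pos[of r] u_pos[of s] by force
  have third: "\<exists>q\<in>S. q \<noteq> r \<and> q \<noteq> s" for r s
  proof (rule ccontr)
    assume "\<not> ?thesis"
    then have "S \<subseteq> {r, s}" by blast
    then have "card S \<le> card {r, s}" by (intro card_mono) auto
    also have "\<dots> \<le> 2" by (simp add: card_insert_if)
    finally show False using assms(1) by simp
  qed
  \<comment> \<open>Go round the triangle \<open>r\<close>, \<open>s\<close>, \<open>q\<close>: each
    edge switches between \<open>x\<close> and \<open>y\<close>, so after three edges
    \<open>x\<close> at \<open>r\<close> has become \<open>y\<close> at \<open>r\<close>.\<close>
  have xy: "x r / u r = y r / u r" if "r \<in> S" for r
  proof -
    obtain s where s: "s \<in> S" "s \<noteq> r" using third by blast
    obtain q where q: "q \<in> S" "q \<noteq> r" "q \<noteq> s" using third by blast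
    have "x r / u r = y s / u s" using ratio that s by metis
    also have "\<dots> = x q / u q" using ratio q s by metis
    also have "\<dots> = y r / u r" using ratio q that by metis
    finally show ?thesis .
  qed
  obtain p where p: "p \<in> S" using third by blast
  have y: "y r / u r = x p / u p" if "r \<in> S" for r
    using xy[OF that] ratio[OF p that] by (cases "r = p") metis+
  then have "x r / u r = x p / u p" if "r \<in> S" for r
    using xy[OF that] that by metis
  then have "x r = x p / u p * u r \<and> y r = x p / u p * u r" if "r \<in> S" for r
    using y[OF that] u_pos[OF that] that by (metis less_irrefl nonzero_eq_divide_eq)
  then show ?thesis by blast
qed

end

text \<open>The norm fixes the absolute value of the factor, and nonnegativity fixes its
  sign.\<close>

lemma L2_set_eq_1_proportional_unique:
  fixes u :: "'a \<Rightarrow> real"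
  assumes "L2_set x S = 1" "L2_set y S = 1"
    and "\<forall>r\<in>S. 0 < u r" "\<forall>r\<in>S. 0 \<le> x r" "\<forall>r\<in>S. 0 \<le> y r"
    and x: "\<forall>r\<in>S. x r = c * u r" and y: "\<forall>r\<in>S. y r = d * u r"
  shows "c = d"
proof -
  have norms: "\<bar>c\<bar> * L2_set u S = 1" "\<bar>d\<bar> * L2_set u S = 1"
    using assms(1,2) x y
    by (simp_all add: L2_set_def power_mult_distrib real_sqrt_mult cong: sum.cong
        flip: sum_distrib_left)
  then have "\<bar>c\<bar> = \<bar>d\<bar>" by (metis mult_cancel_right mult_zero_right zero_neq_one)
  moreover obtain r where "r \<in> S"
    using assms(1) by (metis L2_set_empty all_not_in_conv zero_neq_one)
  then have "0 \<le> c" "0 \<le> d"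
    using assms(3-) by (metis zero_le_mult_iff not_less)+
  ultimately show ?thesis by simp
qed

section \<open>The kernel and the points of the grid\<close>

definition grid_kernel :: "int ^ 'n \<Rightarrow> int ^ 'n \<Rightarrow> real" where
  "grid_kernel r s = 1 / euclid_norm (r - s) ^ CARD('n)"

lemma euclid_norm_minus_commute: "euclid_norm (r - s) = euclid_norm (s - r)"
proof -
  have "(\<chi> i. real_of_int ((r - s) $ i)) = - (\<chi> i. real_of_int ((s - r) $ i))"
    by (simp add: vec_eq_iff)
  then show ?thesis by (simp add: euclid_norm_def del: vector_minus_component)
qed

lemma grid_kernel_commute: "grid_kernel r s = grid_kernel s r"
  by (simp add: grid_kernel_def euclid_norm_minus_commute[of r s])

lemma grid_kernel_pos:
  assumes "r \<noteq> s"
  shows "0 < grid_kernel r s"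
proof -
  have "(\<chi> i. real_of_int ((r - s) $ i)) \<noteq> 0"
    using assms by (simp add: vec_eq_iff)
  then show ?thesis by (simp add: grid_kernel_def euclid_norm_def)
qed

lemma finite_grid: "finite (grid N :: (int ^ 'n) set)"
proof -
  have "grid N \<subseteq> vec_lambda ` (UNIV \<rightarrow>\<^sub>E {1..int N} :: ('n \<Rightarrow> int) set)"
  proof
    fix r :: "int ^ 'n" assume "r \<in> grid N"
    then have "vec_nth r \<in> UNIV \<rightarrow>\<^sub>E {1..int N}" by (simp add: grid_def PiE_def)
    then show "r \<in> vec_lambda ` (UNIV \<rightarrow>\<^sub>E {1..int N})"
      by (metis image_eqI vec_nth_inverse)
  qed
  then show ?thesis by (rule finite_subset) (simp add: finite_PiE)
qed

lemma grid_1: "grid 1 = {vec 1}"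
  by (auto simp: grid_def vec_eq_iff order_eq_iff)

lemma card_grid_ge_3:
  assumes "N \<ge> 2" "\<not> (CARD('n) = 1 \<and> N = 2)"
  shows "3 \<le> card (grid N :: (int ^ 'n) set)"
proof -
  obtain p :: "int ^ 'n" where p: "p \<in> grid N" "p \<noteq> vec 1" "p \<noteq> vec 2"
  proof (cases "N = 2")
    case False
    show ?thesis
      by (rule that[of "vec 3"]) (use False assms in \<open>auto simp: grid_def vec_eq_iff\<close>)
  next
    case True
    then have "CARD('n) \<noteq> 1" using assms by blast
    then obtain i j :: 'n where "i \<noteq> j"
      by (metis (full_types) card_1_singleton_iff One_nat_def UNIV_eq_I singletonI)
    \<comment> \<open>In dimension at least 2 a vector with both entries 1 and 2 is neither of the
      constant vectors.\<close>
    then show ?thesis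
      by (intro that[of "\<chi> k. if k = i then 1 else 2"])
        (use assms in \<open>auto simp: grid_def vec_eq_iff\<close>)
  qed
  have "vec 1 \<noteq> (vec 2 :: int ^ 'n)" by (simp add: vec_eq_iff)
  then have "3 = card {vec 1, vec 2, p}" using p by auto
  also have "\<dots> \<le> card (grid N :: (int ^ 'n) set)"
    by (rule card_mono[OF finite_grid]) (use p assms in \<open>auto simp: grid_def\<close>)
  finally show ?thesis .
qed

lemma hilbert_form_eq: "hilbert_form N a b = off_diag_form (grid N) grid_kernel a b"
  by (simp add: hilbert_form_def off_diag_form_def grid_kernel_def)

section \<open>Solutions of the coupled system\<close>

lemma nonneg_solutionD:
  fixes a b :: "int ^ 'n \<Rightarrow> real"
  assumes "nonneg_solution N a b \<mu>\<^sub>1 \<mu>\<^sub>2"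
  shows "\<And>r. r \<in> grid N \<Longrightarrow> 0 \<le> a r" "\<And>r. r \<in> grid N \<Longrightarrow> 0 \<le> b r"
    "L2_set a (grid N) = 1" "L2_set b (grid N) = 1"
    "\<And>r. r \<in> grid N \<Longrightarrow> \<mu>\<^sub>1 * a r = (\<Sum>s\<in>grid N - {r}. grid_kernel r s * b s)"
    "\<And>r. r \<in> grid N \<Longrightarrow> \<mu>\<^sub>2 * b r = (\<Sum>s\<in>grid N - {r}. grid_kernel r s * a s)"
  using assms
  by (simp_all add: nonneg_solution_def grid_kernel_def euclid_norm_minus_commute)

lemma nonneg_solution_form:
  fixes a b :: "int ^ 'n \<Rightarrow> real"
  assumes "nonneg_solution N a b \<mu>\<^sub>1 \<mu>\<^sub>2"
  shows "hilbert_form N a b = \<mu>\<^sub>1" "\<mu>\<^sub>2 = \<mu>\<^sub>1"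
proof -
  note D = nonneg_solutionD[OF assms]
  show 1: "hilbert_form N a b = \<mu>\<^sub>1"
    unfolding hilbert_form_eq by (rule off_diag_form_eigen[OF D(5,3)])
  have "off_diag_form (grid N) grid_kernel b a = \<mu>\<^sub>2"
    by (rule off_diag_form_eigen[OF D(6,4)])
  then show "\<mu>\<^sub>2 = \<mu>\<^sub>1"
    using 1 by (simp add: hilbert_form_eq
        off_diag_form_commute[where K = grid_kernel and x = b, OF finite_grid grid_kernel_commute])
qed

text \<open>The two equations are coupled, but as their eigenvalues agree, adding them makes
  \<open>a + b\<close> an eigenvector. It is positive even where \<open>a\<close> or
  \<open>b\<close> has a zero, as happens on the two-point grid.\<close>

lemma nonneg_solution_sum:
  fixes a b :: "int ^ 'n \<Rightarrow> real"
  assumes "nonneg_solution N a b \<mu>\<^sub>1 \<mu>\<^sub>2" "r \<in> grid N"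
  shows "\<mu>\<^sub>1 * (a r + b r) = (\<Sum>s\<in>grid N - {r}. grid_kernel r s * (a s + b s))"
    and "0 < a r + b r"
proof -
  note D = nonneg_solutionD[OF assms(1)]
  have eigen: "\<mu>\<^sub>1 * (a r + b r) = (\<Sum>s\<in>grid N - {r}. grid_kernel r s * (a s + b s))"
    if "r \<in> grid N" for r
    using D(5,6)[OF that] nonneg_solution_form(2)[OF assms(1)]
    by (simp add: ring_distribs sum.distrib)
  then show "\<mu>\<^sub>1 * (a r + b r) = (\<Sum>s\<in>grid N - {r}. grid_kernel r s * (a s + b s))"
    using assms(2) .
  obtain p where p: "p \<in> grid N" "a p \<noteq> 0"
    using D(3) by (metis (mono_tags) L2_set_0' zero_neq_one)
  show "0 < a r + b r"
    by (rule eigenvector_pos[OF finite_grid, where K = grid_kernel and p = p])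
      (use D(1,2) p eigen assms(2) in \<open>auto intro: grid_kernel_pos simp: add_nonneg_eq_0_iff\<close>)
qed

lemma nonneg_solution_lambda_max:
  fixes a b :: "int ^ 'n \<Rightarrow> real"
  assumes "nonneg_solution N a b \<mu>\<^sub>1 \<mu>\<^sub>2"
  shows "\<mu>\<^sub>1 = lambda_max TYPE('n) N" "\<mu>\<^sub>2 = lambda_max TYPE('n) N"
proof -
  note D = nonneg_solutionD[OF assms]
  have "hilbert_form N x y \<le> \<mu>\<^sub>1"
    if "L2_set x (grid N) = 1" "L2_set y (grid N) = 1" for x y :: "int ^ 'n \<Rightarrow> real"
    unfolding hilbert_form_eq
    using finite_grid grid_kernel_commute grid_kernel_pos nonneg_solution_sum(2,1)[OF assms] that
    by (rule off_diag_form_le)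
  then show "\<mu>\<^sub>1 = lambda_max TYPE('n) N"
    unfolding lambda_max_def
    using D(3,4) nonneg_solution_form(1)[OF assms] by (intro Greatest_equality[symmetric]) auto
  then show "\<mu>\<^sub>2 = lambda_max TYPE('n) N"
    using nonneg_solution_form(2)[OF assms] by simp
qed

text \<open>Both \<open>a'\<close> and \<open>b'\<close> are compared with \<open>a\<close>, so that
  taking the second solution equal to the first yields \<open>a = b\<close>.\<close>

lemma nonneg_solution_unique:
  fixes a b a' b' :: "int ^ 'n \<Rightarrow> real"
  assumes "N \<ge> 1" "\<not> (CARD('n) = 1 \<and> N = 2)"
    and ab: "nonneg_solution N a b \<mu>\<^sub>1 \<mu>\<^sub>2" and ab': "nonneg_solution N a' b' \<mu>\<^sub>1' \<mu>\<^sub>2'"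
    and r: "r \<in> grid N"
  shows "a' r = a r" "b' r = a r"
proof -
  note D = nonneg_solutionD[OF ab] and D' = nonneg_solutionD[OF ab']
  have "a' r = a r \<and> b' r = a r"
  proof (cases "N = 1")
    case True
    then have "r = vec 1" using r grid_1 by blast
    \<comment> \<open>On a single point, a nonnegative vector of norm 1 has the entry 1.\<close>
    then show ?thesis
      using r D(1,3) D'(1-4) True by (simp add: L2_set_def grid_1[simplified])
  next
    case False
    then have card: "3 \<le> card (grid N :: (int ^ 'n) set)"
      using assms(1,2) by (intro card_grid_ge_3) auto
    define u where "u = (\<lambda>r. a r + b r)"
    have u: "\<mu>\<^sub>1 * u r = (\<Sum>s\<in>grid N - {r}. grid_kernel r s * u s)" "0 < u r" if "r \<in> grid N" for r
      using nonneg_solution_sum[OF ab that] by (simp_all add: u_def)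
    have maximiser: "\<exists>c. \<forall>r\<in>grid N. x r = c * u r \<and> y r = c * u r"
      if "L2_set x (grid N) = 1" "L2_set y (grid N) = 1" "hilbert_form N x y = \<mu>\<^sub>1" for x y
      using finite_grid grid_kernel_commute grid_kernel_pos u(2,1) card that
      unfolding hilbert_form_eq by (rule off_diag_maximiser)
    \<comment> \<open>The second pair also attains \<open>\<mu>\<^sub>1\<close>, since both
      eigenvalues equal the maximum of the form.\<close>
    have "hilbert_form N a b = \<mu>\<^sub>1" "hilbert_form N a' b' = \<mu>\<^sub>1"
      using nonneg_solution_form(1) nonneg_solution_lambda_max(1) ab ab' by metis+
    then obtain c d where c: "\<forall>r\<in>grid N. a r = c * u r"
        and d: "\<forall>r\<in>grid N. a' r = d * u r \<and> b' r = d * u r"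
      using maximiser[OF D(3,4)] maximiser[OF D'(3,4)] by blast
    have "c = d"
      using L2_set_eq_1_proportional_unique[OF D(3) D'(3), of u c d] c d u(2) D(1) D'(1) by blast
    then show ?thesis using c d r by simp
  qed
  then show "a' r = a r" "b' r = a r" by auto
qed

theorem theorem6:
  fixes N :: nat and a b :: "int ^ 'n \<Rightarrow> real" and \<mu>\<^sub>1 \<mu>\<^sub>2 :: real
  assumes "N \<ge> 1"
    and "nonneg_solution N a b \<mu>\<^sub>1 \<mu>\<^sub>2"
  shows "\<mu>\<^sub>1 = lambda_max TYPE('n) N \<and> \<mu>\<^sub>2 = lambda_max TYPE('n) N \<and>
    (\<not> (CARD('n) = 1 \<and> N = 2) \<longrightarrow>
       (\<forall>r\<in>grid N. a r = b r \<and> 0 < a r) \<and>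
       (\<forall>a' b' \<mu>\<^sub>1' \<mu>\<^sub>2'. nonneg_solution N a' b' \<mu>\<^sub>1' \<mu>\<^sub>2' \<longrightarrow>
          (\<forall>r\<in>grid N. a' r = a r \<and> b' r = b r) \<and> \<mu>\<^sub>1' = \<mu>\<^sub>1 \<and> \<mu>\<^sub>2' = \<mu>\<^sub>2))"
proof (intro conjI impI)
  show "\<mu>\<^sub>1 = lambda_max TYPE('n) N" "\<mu>\<^sub>2 = lambda_max TYPE('n) N"
    using nonneg_solution_lambda_max[OF assms(2)] by auto
  assume "\<not> (CARD('n) = 1 \<and> N = 2)"
  note unique = nonneg_solution_unique[OF assms(1) this assms(2)]
  \<comment> \<open>Uniqueness is applied to \<open>(a, b)\<close> against itself; positivity of
    \<open>a + b\<close> then gives that of \<open>a\<close>.\<close>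
  show eq: "\<forall>r\<in>grid N. a r = b r \<and> 0 < a r"
    using unique(2)[OF assms(2)] nonneg_solution_sum(2)[OF assms(2)] by force
  show "\<forall>a' b' \<mu>\<^sub>1' \<mu>\<^sub>2'. nonneg_solution N a' b' \<mu>\<^sub>1' \<mu>\<^sub>2' \<longrightarrow>
          (\<forall>r\<in>grid N. a' r = a r \<and> b' r = b r) \<and> \<mu>\<^sub>1' = \<mu>\<^sub>1 \<and> \<mu>\<^sub>2' = \<mu>\<^sub>2"
  proof (intro allI impI)
    fix a' b' :: "int ^ 'n \<Rightarrow> real" and \<mu>\<^sub>1' \<mu>\<^sub>2'
    assume sol: "nonneg_solution N a' b' \<mu>\<^sub>1' \<mu>\<^sub>2'"
    show "(\<forall>r\<in>grid N. a' r = a r \<and> b' r = b r) \<and> \<mu>\<^sub>1' = \<mu>\<^sub>1 \<and> \<mu>\<^sub>2' = \<mu>\<^sub>2"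
      using unique[OF sol] eq nonneg_solution_lambda_max[OF sol]
        nonneg_solution_lambda_max[OF assms(2)] by auto
  qed
qed

end
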